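(* For all integers $d\ge 2$, we have $R_p(d)\le 2d-2$; that is, for every $n\ge 2d-1$, every labeling of the edges of ${\overset{\leftrightarrow}{K}}_n$ by permutations of $[d]$ has a fixed-point cycle.
   Context: For an integer $n\ge 1$, ${\overset{\leftrightarrow}{K}}_n$ denotes the complete bidirected graph on $n$ vertices: for every pair of distinct vertices $u,v$ it has both directed edges $(u,v)$ and $(v,u)$. Let $[d]=\{1,\dots,d\}$. A permutation $d$-labeling assigns to every directed edge $e$ a bijection $\ell_e:[d]\to[d]$. A cycle means a simple directed cycle. If a cycle has edges $e_1,\dots,e_k$ in this order with labels $f_1,\dots,f_k$, it is a fixed-point cycle if the map $x\mapsto f_k(f_{k-1}(\cdots f_1(x)\cdots))$ has a fixed point in $[d]$. $R_p(d)$ is the largest $n$ such that there exists a permutation $d$-labeling of ${\overset{\leftrightarrow}{K}}_n$ with no fixed-point cycle. *)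

theory Defs
  imports "Graph_Theory.Graph_Theory"
begin

definition complete_bidirected :: "nat \<Rightarrow> (nat, nat \<times> nat) pre_digraph" where
  "complete_bidirected n =
     \<lparr> verts = {0..<n}, arcs = {(u, v). u < n \<and> v < n \<and> u \<noteq> v}, tail = fst, head = snd \<rparr>"

lemma complete_digraph_complete_bidirected: "complete_digraph n (complete_bidirected n)"
proof -
  have "complete_bidirected n =
      with_proj \<lparr> pverts = {0..<n}, parcs = {(u, v). u < n \<and> v < n \<and> u \<noteq> v} \<rparr>"
    by (simp add: complete_bidirected_def with_proj_def)
  then show ?thesis
    by (simp only: complete_digraph_pair_def) auto
qed

definition permutation_labeling :: "nat \<Rightarrow> ('a, 'b) pre_digraph \<Rightarrow> ('b \<Rightarrow> nat \<Rightarrow> nat) \<Rightarrow> bool" where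
  "permutation_labeling d G l \<longleftrightarrow> (\<forall>e \<in> arcs G. bij_betw (l e) {1..d} {1..d})"

text \<open>For a cycle \<open>p = [e1, \<dots>, ek]\<close> the term \<open>fold l p x\<close> is \<open>l ek (\<dots> (l e1 x))\<close>.
  The library's cycles are nonempty and include those of length two.\<close>

definition fixed_point_cycle ::
    "nat \<Rightarrow> ('a, 'b) pre_digraph \<Rightarrow> ('b \<Rightarrow> nat \<Rightarrow> nat) \<Rightarrow> 'b list \<Rightarrow> bool" where
  "fixed_point_cycle d G l p \<longleftrightarrow> pre_digraph.cycle G p \<and> (\<exists>x \<in> {1..d}. fold l p x = x)"

text \<open>\<open>GREATEST\<close> is only meaningful if the admissible \<open>n\<close> are bounded; a bound on \<open>R_p d\<close>
  should therefore be accompanied by the statement that no larger \<open>n\<close> is admissible.\<close>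

definition R_p :: "nat \<Rightarrow> nat" where
  "R_p d = (GREATEST n. 1 \<le> n \<and>
     (\<exists>l. permutation_labeling d (complete_bidirected n) l \<and>
          \<not> (\<exists>p. fixed_point_cycle d (complete_bidirected n) l p)))"

end

theory Submission
  imports Defs
begin

text \<open>
  Generalise to vertex-dependent colour sets \<open>C v\<close> of size \<open>d\<close> and induct on \<open>d\<close>. Fix a start
  vertex and colour, and let \<open>S\<close> be a set of \<open>k + 1\<close> colours that paths inside a set \<open>W\<close> of
  \<open>2k + 1\<close> vertices produce at a vertex \<open>v\<close>. For \<open>a \<noteq> b\<close> outside \<open>W\<close>, compare the images of \<open>S\<close>
  under \<open>v \<rightarrow> a\<close> and \<open>v \<rightarrow> b \<rightarrow> a\<close>. If they differ for some \<open>a, b\<close>, then adding \<open>a, b\<close> to \<open>W\<close>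
  gives at least \<open>k + 2\<close> colours at \<open>a\<close>. If they never differ, the images of \<open>S\<close> at the vertices
  outside \<open>W\<close> are mapped to each other, hence so are their complements; these have size
  \<open>d - k - 1\<close>, at least \<open>2 (d - k - 1)\<close> vertices remain, and the induction hypothesis applies. Once
  all \<open>d\<close> colours are produced at \<open>v\<close>, the arc back to the start closes a fixed-point cycle.
\<close>

lemma (in wf_digraph) apath_snoc:
  assumes "apath u p (tail G e)" "e \<in> arcs G" "head G e \<notin> set (awalk_verts u p)"
  shows "apath u (p @ [e]) (head G e)"
    and "set (awalk_verts u (p @ [e])) = insert (head G e) (set (awalk_verts u p))"
proof -
  have p: "awalk u p (tail G e)" "distinct (awalk_verts u p)"
    using assms(1) by (auto simp: apath_def)
  have e: "awalk (tail G e) [e] (head G e)"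
    using assms(2) by (rule arc_implies_awalk)
  have pe: "awalk u (p @ [e]) (head G e)"
    using p(1) e by (rule awalk_appendI)
  have "awalk_verts u (p @ [e]) = awalk_verts u p @ [head G e]"
    using awalk_verts_append[OF pe] by simp
  then show "apath u (p @ [e]) (head G e)"
    and "set (awalk_verts u (p @ [e])) = insert (head G e) (set (awalk_verts u p))"
    using pe p(2) assms(3) by (auto simp: apath_def)
qed

text \<open>\<open>cycle\<close> asks for distinctness only after dropping the first vertex.
  Dropping the initial \<open>u\<close> makes room for the final one.\<close>

lemma (in wf_digraph) apath_close_cycle:
  assumes "apath u p (tail G e)" "e \<in> arcs G" "head G e = u"
  shows "cycle (p @ [e])"
proof -
  have p: "awalk u p (tail G e)" "distinct (awalk_verts u p)"
    using assms(1) by (auto simp: apath_def)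
  have e: "awalk (tail G e) [e] u"
    using arc_implies_awalk[OF assms(2)] assms(3) by simp
  have pe: "awalk u (p @ [e]) u"
    using p(1) e by (rule awalk_appendI)
  have "awalk_verts u (p @ [e]) = awalk_verts u p @ [u]"
    using awalk_verts_append[OF pe] assms(3) by simp
  moreover obtain vs where "awalk_verts u p = u # vs"
    using p(1) by (metis awhd_of_awalk awalk_verts_non_Nil list.collapse)
  ultimately have "distinct (tl (awalk_verts u (p @ [e])))"
    using p(2) by simp
  then show ?thesis
    using pe unfolding cycle_def by blast
qed

text \<open>Confining the simple paths to \<open>W\<close> guarantees that any vertex outside
  \<open>W\<close> can be appended without a repetition.\<close>

definition (in pre_digraph) reached ::
    "('b \<Rightarrow> 'c \<Rightarrow> 'c) \<Rightarrow> 'a \<Rightarrow> 'c \<Rightarrow> 'a set \<Rightarrow> 'a \<Rightarrow> 'c set" where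
  "reached l u x W v = {fold l p x | p. apath u p v \<and> set (awalk_verts u p) \<subseteq> W}"

lemma (in pre_digraph) reached_mono: "W \<subseteq> W' \<Longrightarrow> reached l u x W v \<subseteq> reached l u x W' v"
  unfolding reached_def by blast

lemma (in wf_digraph) reached_step:
  assumes "e \<in> arcs G" "tail G e = v" "head G e = w" "w \<notin> W"
  shows "l e ` reached l u x W v \<subseteq> reached l u x (insert w W) w"
proof
  fix y assume "y \<in> l e ` reached l u x W v"
  then obtain p where p: "apath u p v" "set (awalk_verts u p) \<subseteq> W" "y = l e (fold l p x)"
    unfolding reached_def by blast
  have "head G e \<notin> set (awalk_verts u p)"
    using p(2) assms by blast
  note apath_snoc[OF p(1)[folded assms(2)] assms(1) this]
  then have "apath u (p @ [e]) w" "set (awalk_verts u (p @ [e])) \<subseteq> insert w W"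
    using p(2) assms(3) by auto
  moreover have "y = fold l (p @ [e]) x"
    using p(3) by simp
  ultimately show "y \<in> reached l u x (insert w W) w"
    unfolding reached_def by blast
qed

lemma wf_digraph_complete_bidirected: "wf_digraph (complete_bidirected n)"
  by standard (auto simp: complete_bidirected_def)

lemma complete_bidirected_simps [simp]:
  "verts (complete_bidirected n) = {0..<n}"
  "(u, v) \<in> arcs (complete_bidirected n) \<longleftrightarrow> u < n \<and> v < n \<and> u \<noteq> v"
  "tail (complete_bidirected n) e = fst e"
  "head (complete_bidirected n) e = snd e"
  by (auto simp: complete_bidirected_def)

text \<open>The map of the arc back to \<open>u\<close> is onto \<open>B\<close>, so it sends some
  colour in \<open>A\<close> to \<open>x\<close>. A path carrying \<open>x\<close> to that colour
  exists, and the arc closes it.\<close>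

lemma fixed_point_cycle_if_reached_all:
  assumes "u < n" "v < n" "u \<noteq> v" "bij_betw (l (v, u)) A B" "x \<in> B"
    and "A \<subseteq> pre_digraph.reached (complete_bidirected n) l u x W v"
  shows "\<exists>p. pre_digraph.cycle (complete_bidirected n) p \<and> fold l p x = x"
proof -
  interpret wf_digraph "complete_bidirected n"
    by (rule wf_digraph_complete_bidirected)
  have "x \<in> l (v, u) ` A"
    using assms(4,5) by (simp add: bij_betw_def)
  then obtain y where y: "x = l (v, u) y" "y \<in> A"
    by (rule imageE)
  then obtain p where p: "apath u p v" "y = fold l p x"
    using assms(6) unfolding reached_def by blast
  have "cycle (p @ [(v, u)])"
    by (rule apath_close_cycle) (use p(1) assms in auto)
  moreover have "fold l (p @ [(v, u)]) x = x"
    using p(2) y(1) by simp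
  ultimately show ?thesis by blast
qed

text \<open>Vertex-dependent colour sets let the induction pass to complements that vary from vertex
  to vertex, and the subset \<open>V\<close> lets it discard vertices. The bound
  \<open>2 \<le> card V\<close> matters at \<open>d = 1\<close>, where \<open>2 * d - 1\<close>
  would admit a single vertex.\<close>

lemma fixed_point_cycle_vertex_colors:
  assumes "V \<subseteq> {0..<n}"
    and "\<And>v. v \<in> V \<Longrightarrow> card (C v) = d"
    and "\<And>u v. u \<in> V \<Longrightarrow> v \<in> V \<Longrightarrow> u \<noteq> v \<Longrightarrow> bij_betw (l (u, v)) (C u) (C v)"
    and "1 \<le> d" "2 * d - 1 \<le> card V" "2 \<le> card V"
  shows "\<exists>p. pre_digraph.cycle (complete_bidirected n) p \<and> (\<exists>v\<in>V. \<exists>x\<in>C v. fold l p x = x)"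
  using assms
proof (induction d arbitrary: V C rule: less_induct)
  case (less d)
  note V = less.prems(1) and card_C = less.prems(2) and bij = less.prems(3)
  interpret wf_digraph "complete_bidirected n"
    by (rule wf_digraph_complete_bidirected)
  have fin_V: "finite V"
    using V finite_subset by blast
  have fin_C: "finite (C v)" if "v \<in> V" for v
    using card_C[OF that] less.prems(4) by (metis card.infinite not_one_le_zero)
  have lt: "v < n" if "v \<in> V" for v
    using V that by auto
  let ?thesis = "\<exists>p. cycle p \<and> (\<exists>v\<in>V. \<exists>x\<in>C v. fold l p x = x)"
  show ?case
  proof (cases "d = 1")
    case True
    obtain u v where uv: "u \<in> V" "v \<in> V" "u \<noteq> v"
      using less.prems(6) card_le_Suc0_iff_eq[OF fin_V] by force
    obtain x y where x: "C u = {x}" and y: "C v = {y}"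
      using card_C uv True by (metis card_1_singletonE)
    \<comment> \<open>With one colour per vertex, a single arc already reaches all of
      \<open>C v\<close>, and the cycle has length two.\<close>
    have "apath u [(u, v)] v"
      using uv lt by (auto simp: apath_def awalk_simps)
    moreover have "fold l [(u, v)] x = y"
      using bij[OF uv] x y by (auto simp: bij_betw_def)
    ultimately have "C v \<subseteq> reached l u x UNIV v"
      unfolding reached_def y by blast
    from fixed_point_cycle_if_reached_all[OF lt lt uv(3) bij _ this] show ?thesis
      using uv x by blast
  next
    case False
    then have d: "2 \<le> d" using less.prems(4) by simp
    \<comment> \<open>The disjunct \<open>?thesis\<close> is there because the outer induction
      hypothesis may yield a cycle at any stage. At \<open>k = 0\<close> only the empty path is
      available, so \<open>u = v\<close>; later \<open>u \<noteq> v\<close> ensures that a closing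
      arc exists.\<close>
    have grow: "?thesis \<or> (\<exists>u v x W S. u \<in> W \<and> v \<in> W \<and> W \<subseteq> V \<and> card W = 2 * k + 1 \<and> x \<in> C u \<and>
        S \<subseteq> C v \<and> S \<subseteq> reached l u x W v \<and> card S = k + 1 \<and> (k \<noteq> 0 \<longrightarrow> u \<noteq> v))"
      if "k < d" for k
      using that
    proof (induction k)
      case 0
      obtain u where u: "u \<in> V"
        using less.prems(6) by fastforce
      then obtain x where x: "x \<in> C u"
        using card_C d by fastforce
      have "apath u [] u"
        using lt[OF u] by (simp add: apath_Nil_iff)
      then have "{x} \<subseteq> reached l u x {u} u"
        unfolding reached_def by (auto intro!: exI[of _ "[]"])
      then show ?case
        using u x by (intro disjI2 exI[of _ u] exI[of _ x] exI[of _ "{u}"] exI[of _ "{x}"]) auto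
    next
      case (Suc k)
      show ?case
      proof (cases ?thesis)
        case no_cycle: False
        then obtain u v x W S where W: "u \<in> W" "v \<in> W" "W \<subseteq> V" "card W = 2 * k + 1"
          and x: "x \<in> C u" and S: "S \<subseteq> C v" "S \<subseteq> reached l u x W v" "card S = k + 1"
          using Suc by auto
        define T where "T a = l (v, a) ` S" for a
        have v: "v \<in> V" using W by auto
        have va: "v \<noteq> a" if "a \<in> V - W" for a
          using that W by auto
        have T_sub: "T a \<subseteq> C a" and card_T: "card (T a) = k + 1" if "a \<in> V - W" for a
        proof -
          have "bij_betw (l (v, a)) (C v) (C a)"
            using bij[OF v _ va[OF that]] that by simp
          then show "T a \<subseteq> C a" "card (T a) = k + 1"
            unfolding T_def using S(1,3)
            by (auto simp: bij_betw_def card_image inj_on_subset)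
        qed
        show ?thesis
        proof (cases "\<exists>a\<in>V - W. \<exists>b\<in>V - W. a \<noteq> b \<and> l (b, a) ` T b \<noteq> T a")
          case True
          then obtain a b where ab: "a \<in> V - W" "b \<in> V - W" "a \<noteq> b" "l (b, a) ` T b \<noteq> T a"
            by blast
          have bij_ba: "bij_betw (l (b, a)) (C b) (C a)"
            using bij ab by auto
          define W' where "W' = insert a (insert b W)"
          define U where "U = T a \<union> l (b, a) ` T b"
          have Tb: "T b \<subseteq> reached l u x (insert b W) b"
          proof -
            have "l (v, b) ` reached l u x W v \<subseteq> reached l u x (insert b W) b"
              by (rule reached_step) (use ab v va[OF ab(2)] lt in auto)
            then show ?thesis unfolding T_def using S(2) by blast
          qed
          have "T a \<subseteq> reached l u x (insert a W) a"
          proof -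
            have "l (v, a) ` reached l u x W v \<subseteq> reached l u x (insert a W) a"
              by (rule reached_step) (use ab v va[OF ab(1)] lt in auto)
            then show ?thesis unfolding T_def using S(2) by blast
          qed
          also have "\<dots> \<subseteq> reached l u x W' a"
            unfolding W'_def by (rule reached_mono) auto
          finally have "T a \<subseteq> reached l u x W' a" .
          moreover have "l (b, a) ` T b \<subseteq> reached l u x W' a"
          proof -
            have "l (b, a) ` reached l u x (insert b W) b \<subseteq> reached l u x W' a"
              unfolding W'_def by (rule reached_step) (use ab lt in auto)
            then show ?thesis using Tb by blast
          qed
          ultimately have U_reached: "U \<subseteq> reached l u x W' a"
            unfolding U_def by blast
          have U_sub: "U \<subseteq> C a"
            unfolding U_def using T_sub[OF ab(1)] T_sub[OF ab(2)] bij_ba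
            by (auto simp: bij_betw_def)
          have fin_U: "finite U"
            using U_sub fin_C ab(1) finite_subset by blast
          \<comment> \<open>The two images at \<open>a\<close> have equal finite size, so being
            different means that neither contains the other, and their union \<open>U\<close> is
            strictly larger than \<open>T a\<close>.\<close>
          have "inj_on (l (b, a)) (T b)"
            using bij_ba T_sub[OF ab(2)] by (auto simp: bij_betw_def intro: inj_on_subset)
          then have "card (l (b, a) ` T b) = card (T a)"
            using card_T[OF ab(1)] card_T[OF ab(2)] by (simp add: card_image)
          moreover have "finite (T a)"
            using fin_U unfolding U_def by simp
          ultimately have "\<not> l (b, a) ` T b \<subseteq> T a"
            using ab(4) card_subset_eq by blast
          then have "T a \<subset> U"
            unfolding U_def by blast
          from psubset_card_mono[OF fin_U this] have "k + 2 \<le> card U"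
            using card_T[OF ab(1)] by simp
          \<comment> \<open>\<open>U\<close> may be larger still; it is trimmed because the next
            round needs the exact size for its complements.\<close>
          then obtain S' where S': "S' \<subseteq> U" "card S' = k + 2"
            by (metis obtain_subset_with_card_n)
          have "card W' = 2 * Suc k + 1"
            unfolding W'_def using ab W(4) finite_subset[OF W(3) fin_V] by simp
          moreover have "a \<in> W'" "u \<in> W'" "W' \<subseteq> V" "u \<noteq> a"
            unfolding W'_def using ab W by auto
          moreover have "S' \<subseteq> C a" "S' \<subseteq> reached l u x W' a" "card S' = Suc k + 1"
            using S' U_sub U_reached by auto
          ultimately show ?thesis
            using x by blast
        next
          case False
          define C' where "C' a = C a - T a" for a
          have "\<exists>p. cycle p \<and> (\<exists>w\<in>V - W. \<exists>z\<in>C' w. fold l p z = z)"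
          proof (rule less.IH)
            show "d - Suc k < d" using d by simp
            show "V - W \<subseteq> {0..<n}" using V by auto
            show "card (C' a) = d - Suc k" if "a \<in> V - W" for a
              unfolding C'_def
              using that card_C[of a] fin_C[of a] T_sub[OF that] card_T[OF that]
              by (simp add: card_Diff_subset finite_subset)
            show "bij_betw (l (a, b)) (C' a) (C' b)"
              if "a \<in> V - W" "b \<in> V - W" "a \<noteq> b" for a b
            proof -
              have ab: "bij_betw (l (a, b)) (C a) (C b)"
                by (rule bij) (use that in auto)
              \<comment> \<open>This is the failed case assumption with the roles of
                \<open>a\<close> and \<open>b\<close> exchanged.\<close>
              have "l (a, b) ` T a = T b"
              proof (rule ccontr)
                assume "l (a, b) ` T a \<noteq> T b"
                with that(3) have "b \<noteq> a \<and> l (a, b) ` T a \<noteq> T b" by simp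
                with that(1,2) False show False by (meson bexI)
              qed
              from bij_betw_subset[OF ab T_sub[OF that(1)] this]
              show ?thesis
                unfolding C'_def by (rule bij_betw_DiffI[OF ab _ T_sub T_sub]) (fact that)+
            qed
            \<comment> \<open>Since \<open>Suc k < d\<close>, at least
              \<open>2 * (d - Suc k)\<close> vertices remain. This exceeds the required bound by one
              and is at least 2, which covers the case of a single remaining colour.\<close>
            have "card (V - W) = card V - (2 * k + 1)"
              using W(3,4) fin_V by (simp add: card_Diff_subset finite_subset)
            then show "2 * (d - Suc k) - 1 \<le> card (V - W)" "2 \<le> card (V - W)"
              using less.prems(5) Suc.prems by auto
            show "1 \<le> d - Suc k" using Suc.prems by simp
          qed
          then show ?thesis
            unfolding C'_def by blast
        qed
      qed blast
    qed
    show ?thesis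
    proof (rule ccontr)
      assume no_cycle: "\<not> ?thesis"
      \<comment> \<open>The last stage \<open>k = d - 1\<close> gives \<open>d\<close> colours,
        hence all of \<open>C v\<close>; it is nonzero as \<open>2 \<le> d\<close>, so
        \<open>u \<noteq> v\<close>.\<close>
      have "d - 1 < d" "d - 1 \<noteq> 0" "d - 1 + 1 = d" using d by auto
      then obtain u v x W S where W: "u \<in> W" "v \<in> W" "W \<subseteq> V" "u \<noteq> v"
        and x: "x \<in> C u" and S: "S \<subseteq> C v" "S \<subseteq> reached l u x W v" "card S = d"
        using grow[of "d - 1"] no_cycle by metis
      have uv: "u \<in> V" "v \<in> V" using W by auto
      have "S = C v"
        using card_subset_eq[OF fin_C[OF uv(2)] S(1)] S(3) card_C[OF uv(2)] by simp
      then have "C v \<subseteq> reached l u x W v"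
        using S(2) by simp
      from fixed_point_cycle_if_reached_all[OF lt lt W(4) bij x this] show False
        using no_cycle uv W(4) x by blast
    qed
  qed
qed

theorem theorem4:
  fixes d :: nat
  assumes "d \<ge> 2"
  shows "R_p d \<le> 2 * d - 2 \<and>
    (\<forall>n \<ge> 2 * d - 1. \<forall>l. permutation_labeling d (complete_bidirected n) l \<longrightarrow>
       (\<exists>p. fixed_point_cycle d (complete_bidirected n) l p))"
proof -
  let ?free = "\<lambda>n. 1 \<le> n \<and> (\<exists>l. permutation_labeling d (complete_bidirected n) l \<and>
    \<not> (\<exists>p. fixed_point_cycle d (complete_bidirected n) l p))"
  have ex_cycle: "\<exists>p. fixed_point_cycle d (complete_bidirected n) l p"
    if "2 * d - 1 \<le> n" "permutation_labeling d (complete_bidirected n) l" for n l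
  proof -
    have "\<exists>p. pre_digraph.cycle (complete_bidirected n) p \<and>
        (\<exists>v\<in>{0..<n}. \<exists>x\<in>{1..d}. fold l p x = x)"
    \<comment> \<open>Every vertex receives the same colour set \<open>{1..d}\<close>.\<close>
    proof (rule fixed_point_cycle_vertex_colors)
      show "bij_betw (l (u, v)) {1..d} {1..d}"
        if "u \<in> {0..<n}" "v \<in> {0..<n}" "u \<noteq> v" for u v
        using that \<open>permutation_labeling d (complete_bidirected n) l\<close>
        unfolding permutation_labeling_def by simp
    qed (use assms that(1) in auto)
    then obtain p x where "pre_digraph.cycle (complete_bidirected n) p" "x \<in> {1..d}"
      "fold l p x = x"
      by auto
    then show ?thesis
      unfolding fixed_point_cycle_def by (intro exI[of _ p] conjI bexI[of _ x])
  qed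
  have bound: "n \<le> 2 * d - 2" if "?free n" for n
  proof -
    have "\<not> 2 * d - 1 \<le> n"
      using that ex_cycle by blast
    then show ?thesis by simp
  qed
  \<comment> \<open>One vertex has no arcs, hence no cycles. This witness and \<open>bound\<close>
    ensure that the maximum defining \<open>R_p d\<close> is attained.\<close>
  have "?free 1"
  proof -
    have "arcs (complete_bidirected 1) = {}"
      by (auto simp: complete_bidirected_def)
    then have "permutation_labeling d (complete_bidirected 1) (\<lambda>_. id)"
      "\<not> fixed_point_cycle d (complete_bidirected 1) (\<lambda>_. id) p" for p
      by (auto simp: permutation_labeling_def fixed_point_cycle_def pre_digraph.cycle_def
          pre_digraph.awalk_def)
    then show ?thesis by blast
  qed
  then have "?free (R_p d)"
    unfolding R_p_def by (rule GreatestI_nat) (use bound in blast)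
  with bound ex_cycle show ?thesis by blast
qed

end
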